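(* Let $d, k, N \ge 1$ be integers and let $\Delta \mathbf{W}_1, \dots, \Delta \mathbf{W}_N \in \mathbb{R}^{d \times k}$ be arbitrary real matrices. Let $r$ be a positive integer satisfying $$ r \ge \max\left( \dim \operatorname{span}\Big( \bigcup_{i=1}^N \mathcal{C}(\Delta \mathbf{W}_i) \Big),\ \dim \operatorname{span}\Big( \bigcup_{i=1}^N \mathcal{R}(\Delta \mathbf{W}_i) \Big) \right). $$ Then there exist matrices $\mathbf{B} \in \mathbb{R}^{d \times r}$ and $\mathbf{A} \in \mathbb{R}^{r \times k}$ (not depending on $i$), and matrices $\mathbf{C}_1, \dots, \mathbf{C}_N \in \mathbb{R}^{r \times r}$, such that $$ \Delta \mathbf{W}_i = \mathbf{B}\, \mathbf{C}_i\, \mathbf{A} \quad \text{for all } i \in \{1, \dots, N\}. $$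
   Context: For a matrix $\mathbf{M} \in \mathbb{R}^{d \times k}$, $\mathcal{C}(\mathbf{M}) \subseteq \mathbb{R}^d$ denotes its column space and $\mathcal{R}(\mathbf{M}) \subseteq \mathbb{R}^k$ its row space. $\operatorname{span}(S)$ is the linear subspace spanned by the set $S$, and $\dim$ is the dimension of a real linear subspace. *)

theory Defs
  imports "HOL-Analysis.Analysis"
begin

definition col_space :: "real ^ 'k ^ 'd \<Rightarrow> (real ^ 'd) set"
  where "col_space M = span (columns M)"

definition row_space :: "real ^ 'k ^ 'd \<Rightarrow> (real ^ 'k) set"
  where "row_space M = span (rows M)"

end

(* With S the span of all the column spaces, dim S \<le> r lets S embed linearly into R^r; composing with
   a linear left inverse factors a map fixing S pointwise as B P through R^r, so B P W_i = W_i.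
   Likewise for the rows, via transposes: W_i = W_i Q A. Hence C_i = P W_i Q works. *)

theory Submission
  imports Defs
begin

lemma exists_matrix_factorization_fixing_subspace:
  fixes S :: "(real ^ 'd) set"
  assumes "subspace S" and "dim S \<le> CARD('r::finite)"
  shows "\<exists>(B :: real ^ 'r ^ 'd) (P :: real ^ 'd ^ 'r). \<forall>x\<in>S. (B ** P) *v x = x"
proof -
  \<comment> \<open>The target subspace is all of R^r, of dimension \<open>CARD('r)\<close>. Norm
    preservation serves only to give injectivity on \<open>S\<close>: a vector of \<open>S\<close>
    sent to 0 has norm 0.\<close>
  obtain f :: "real ^ 'd \<Rightarrow> real ^ 'r"
    where f: "linear f" and norm_f: "\<And>x. x \<in> S \<Longrightarrow> norm (f x) = norm x"
    using isometry_subset_subspace[OF assms(1) subspace_UNIV, where ?'b = "real ^ 'r"] assms(2)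
    by auto
  have "inj_on f S"
    using linear_injective_on_subspace_0[OF f assms(1)] norm_f by (metis norm_eq_zero)
  then obtain g where g: "linear g" and gf: "\<forall>x\<in>S. g (f x) = x"
    using linear_exists_left_inverse_on[OF f assms(1)] by blast
  have "(matrix g ** matrix f) *v x = x" if "x \<in> S" for x
    using f g gf that by (simp add: matrix_works flip: matrix_vector_mul_assoc)
  then show ?thesis by blast
qed

text \<open>Left multiplication acts column by column: column j of \<open>M ** W\<close> is
  \<open>M\<close> applied to column j of \<open>W\<close>.\<close>

lemma matrix_mult_eq_self_if_fixes_columns:
  fixes M :: "real ^ 'd ^ 'd" and W :: "real ^ 'k ^ 'd"
  assumes "\<And>x. x \<in> columns W \<Longrightarrow> M *v x = x"
  shows "M ** W = W"
proof -
  have "column j (M ** W) = column j W" for j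
    using assms[of "column j W"] by (auto simp: columns_def matrix_vector_mult_basis[symmetric]
        matrix_vector_mul_assoc)
  then show ?thesis
    by (simp add: column_def vec_eq_iff)
qed

theorem theorem4p1:
  fixes N :: nat
    and W :: "nat \<Rightarrow> real ^ 'k ^ 'd"
  assumes "N \<ge> 1"
    and "CARD('r::finite) \<ge> max (dim (span (\<Union>i\<in>{1..N}. col_space (W i))))
                          (dim (span (\<Union>i\<in>{1..N}. row_space (W i))))"
  shows "\<exists>(B :: real ^ 'r ^ 'd) (A :: real ^ 'k ^ 'r) (C :: nat \<Rightarrow> real ^ 'r ^ 'r).
           \<forall>i\<in>{1..N}. W i = B ** C i ** A"
proof -
  let ?S = "span (\<Union>i\<in>{1..N}. col_space (W i))"
  let ?T = "span (\<Union>i\<in>{1..N}. row_space (W i))"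
  obtain B :: "real ^ 'r ^ 'd" and P where BP: "\<forall>x\<in>?S. (B ** P) *v x = x"
    using exists_matrix_factorization_fixing_subspace[of ?S, where ?'r = 'r] assms(2) by auto
  \<comment> \<open>The row side is handled as a column problem for the transposes, so the right
    factor of the theorem will be \<open>transpose A'\<close>.\<close>
  obtain A' :: "real ^ 'r ^ 'k" and Q' where AQ: "\<forall>x\<in>?T. (A' ** Q') *v x = x"
    using exists_matrix_factorization_fixing_subspace[of ?T, where ?'r = 'r] assms(2) by auto
  have "W i = B ** (P ** W i ** transpose Q') ** transpose A'" if i: "i \<in> {1..N}" for i
  proof -
    have "columns (W i) \<subseteq> ?S" "rows (W i) \<subseteq> ?T"
      using i unfolding col_space_def row_space_def by (blast intro: span_base)+
    \<comment> \<open>The columns of \<open>transpose (W i)\<close> are the rows of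
      \<open>W i\<close>, which lie in \<open>?T\<close>.\<close>
    then have 1: "(B ** P) ** W i = W i" and "(A' ** Q') ** transpose (W i) = transpose (W i)"
      using BP AQ by (auto intro!: matrix_mult_eq_self_if_fixes_columns)
    then have "W i ** (transpose Q' ** transpose A') = W i"
      by (metis matrix_transpose_mul transpose_transpose)
    \<comment> \<open>Inserting one identity into the other gives W = (B P) W (Q'^T A'^T), which is
      then reassociated.\<close>
    with 1 show ?thesis by (metis matrix_mul_assoc)
  qed
  then show ?thesis
    by (intro exI[of _ B] exI[of _ "transpose A'"] exI[of _ "\<lambda>i. P ** W i ** transpose Q'"]) blast
qed

end
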